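(* A formula built from $\Delta^0_2$-predicates, boolean operations and universal and existential quantification over Noetherian quasi-Polish spaces itself defines a $\Delta^0_2$-predicate. Precisely: consider formulas in which every variable is typed by a represented space, the atomic formulas are of the form $R(x_1,\dots,x_m)$ with $R$ a $\Delta^0_2$-subset of the product of the spaces typing $x_1,\dots,x_m$, and formulas are closed under finite boolean operations and under quantification $\forall x\in\mathbf{X}$, $\exists x\in\mathbf{X}$ where $\mathbf{X}$ is a Noetherian quasi-Polish space. Then for every such formula $\varphi(y_1,\dots,y_k)$ with free variables among $y_1,\dots,y_k$ typed by $\mathbf{Y}_1,\dots,\mathbf{Y}_k$, the set $\{(y_1,\dots,y_k)\in\mathbf{Y}_1\times\dots\times\mathbf{Y}_k\mid\varphi(y_1,\dots,y_k)\}$ is a $\Delta^0_2$-subset of $\mathbf{Y}_1\times\dots\times\mathbf{Y}_k$.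
   Context: A represented space is a pair $\mathbf{X}=(X,\delta_{\mathbf{X}})$ of a set $X$ and a partial surjection $\delta_{\mathbf{X}}:\subseteq\mathbb{N}^{\mathbb{N}}\to X$. A map $f:\mathbf{X}\to\mathbf{Y}$ is continuous if there is a continuous partial $F:\subseteq\mathbb{N}^{\mathbb{N}}\to\mathbb{N}^{\mathbb{N}}$ with $\delta_{\mathbf{Y}}(F(p))=f(\delta_{\mathbf{X}}(p))$ for all $p\in\mathrm{dom}(\delta_{\mathbf X})$. Products of represented spaces are represented by pairing names. $\mathbf{2}=\{0,1\}$ is the discrete two-point space with representation $p\mapsto p(0)$ on $\{p\mid p(0)\in\{0,1\}\}$. $\Delta:\subseteq\mathbb{N}^{\mathbb{N}}\to\mathbb{N}^{\mathbb{N}}$ is defined on sequences with only finitely many zeros by $\Delta(p)(n)=p(n+1+\max\{i\mid p(i)=0\})-1$ (with $\max\emptyset:=-1$), and $\mathbf{X}^\nabla:=(X,\delta_{\mathbf{X}}\circ\Delta)$. A subset (predicate) of a represented space $\mathbf{X}$ is $\Delta^0_2$ if its characteristic function $\mathbf{X}\to\mathbf{2}^\nabla$ is continuous. A topological space is Noetherian if every strictly ascending chain of open sets is finite. A (non-empty) topological space is quasi-Polish iff it is countably based and its topology comes from a Smyth-complete quasi-metric; equivalently (known), iff its topology is induced (as final topology) by an open admissible total representation $\delta_{\mathbf{X}}:\mathbb{N}^{\mathbb{N}}\to\mathbf{X}$; equivalently, iff it is homeomorphic to a $\boldsymbol{\Pi}^0_2$-subspace of $\mathcal{P}(\omega)$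 with the Scott topology ($\boldsymbol{\Sigma}^0_2$ sets being countable unions of differences of open sets). Here a representation is admissible if $x\mapsto\{U\in\mathcal{O}(\mathbf{X})\mid x\in U\}:\mathbf{X}\to\mathcal{O}(\mathcal{O}(\mathbf{X}))$ has a continuous partial inverse, where $\mathcal{O}(\mathbf{X})$ is the function space of continuous maps from $\mathbf{X}$ into Sierpi\'nski space. A quasi-Polish space is regarded as a represented space via such an open admissible total representation. *)

theory Defs
  imports "HOL-Analysis.Analysis" "HOL-Library.Nat_Bijection"
begin

section \<open>Represented spaces\<close>

text \<open>
  Baire space is the type \<open>nat \<Rightarrow> nat\<close>; its topology is the library's product topology
  on functions, with \<open>nat\<close> discrete.
\<close>

type_synonym baire = "nat \<Rightarrow> nat"

record 'a rspace =
  points :: "'a set"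
  rep :: "baire \<Rightarrow> 'a option"

abbreviation names :: "'a rspace \<Rightarrow> baire set" where
  "names X \<equiv> dom (rep X)"

definition represented_space :: "'a rspace \<Rightarrow> bool" where
  "represented_space X \<longleftrightarrow> ran (rep X) = points X"

text \<open>
  A partial function on Baire space is given by a domain \<open>D\<close> and a total function whose
  values outside \<open>D\<close> are irrelevant. Likewise, the values of \<open>f\<close> outside \<open>points X\<close>
  are irrelevant.
\<close>

definition rcontinuous :: "'a rspace \<Rightarrow> 'b rspace \<Rightarrow> ('a \<Rightarrow> 'b) \<Rightarrow> bool" where
  "rcontinuous X Y f \<longleftrightarrow>
     (\<exists>D F. names X \<subseteq> D \<and> continuous_on D (F :: baire \<Rightarrow> baire) \<and>
        (\<forall>p x. rep X p = Some x \<longrightarrow> rep Y (F p) = Some (f x)))"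

definition subrspace :: "'a rspace \<Rightarrow> 'a set \<Rightarrow> 'a rspace" where
  "subrspace X A = \<lparr> points = points X \<inter> A, rep = rep X |` (rep X -` Some ` A) \<rparr>"

text \<open>
  A name of a tuple \<open>[x\<^sub>0, \<dots>, x\<^sub>m\<^sub>-\<^sub>1]\<close> interleaves names of its entries; for \<open>m = 2\<close>
  this is the usual pairing of sequences. For \<open>m = 0\<close> the product is the one-point space.
\<close>

definition component :: "nat \<Rightarrow> nat \<Rightarrow> baire \<Rightarrow> baire" where
  "component m i p = (\<lambda>n. p (m * n + i))"

definition prod_rspace :: "'a rspace list \<Rightarrow> 'a list rspace" where
  "prod_rspace Xs =
    (let m = length Xs in
     \<lparr> points = listset (map points Xs),
       rep = (\<lambda>p. if \<forall>i<m. component m i p \<in> names (Xs ! i)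
                  then Some (map (\<lambda>i. the (rep (Xs ! i) (component m i p))) [0..<m])
                  else None) \<rparr>)"


section \<open>\<open>\<Delta>\<^sup>0\<^sub>2\<close>-subsets\<close>

definition two_rspace :: "nat rspace" where
  "two_rspace = \<lparr> points = {0, 1}, rep = (\<lambda>p. if p 0 \<in> {0, 1} then Some (p 0) else None) \<rparr>"

text \<open>
  \<open>after_zeros p\<close> is \<open>1 + max {i. p i = 0}\<close>, where the maximum of the empty set is \<open>-1\<close>.
\<close>

definition after_zeros :: "baire \<Rightarrow> nat" where
  "after_zeros p = (if {i. p i = 0} = {} then 0 else Suc (Max {i. p i = 0}))"

definition Delta :: "baire \<Rightarrow> baire option" where
  "Delta p = (if finite {i. p i = 0} then Some (\<lambda>n. p (n + after_zeros p) - 1) else None)"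

definition nabla :: "'a rspace \<Rightarrow> 'a rspace" where
  "nabla X = \<lparr> points = points X, rep = rep X \<circ>\<^sub>m Delta \<rparr>"

definition Delta02 :: "'a rspace \<Rightarrow> 'a set \<Rightarrow> bool" where
  "Delta02 X A \<longleftrightarrow> A \<subseteq> points X \<and> rcontinuous X (nabla two_rspace) (indicator A)"


section \<open>Function spaces and spaces of open sets\<close>

text \<open>
  A sequence \<open>a\<close> codes a partial continuous function on Baire space as in Kleene's second
  algebra: to find the \<open>n\<close>-th value at \<open>p\<close>, query \<open>a\<close> on \<open>n\<close> and longer and longer initial
  segments of \<open>p\<close> until the answer is a successor \<open>v + 1\<close>; then \<open>v\<close> is the value.
\<close>

definition query :: "baire \<Rightarrow> baire \<Rightarrow> nat \<Rightarrow> nat \<Rightarrow> nat" where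
  "query a p n k = a (list_encode (n # map p [0..<k]))"

definition code_app :: "baire \<Rightarrow> baire \<Rightarrow> baire option" where
  "code_app a p =
     (if \<forall>n. \<exists>k. query a p n k \<noteq> 0
      then Some (\<lambda>n. query a p n (LEAST k. query a p n k \<noteq> 0) - 1)
      else None)"

definition codes_map :: "baire \<Rightarrow> 'a rspace \<Rightarrow> 'b rspace \<Rightarrow> ('a \<Rightarrow> 'b) \<Rightarrow> bool" where
  "codes_map a X Y f \<longleftrightarrow>
     (\<forall>p x. rep X p = Some x \<longrightarrow> (\<exists>q. code_app a p = Some q \<and> rep Y q = Some (f x)))"

definition fun_rspace :: "'a rspace \<Rightarrow> 'b rspace \<Rightarrow> ('a \<Rightarrow> 'b) rspace" where
  "fun_rspace X Y =
    \<lparr> points = {f \<in> extensional (points X). rcontinuous X Y f},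
      rep = (\<lambda>a. if \<exists>f. codes_map a X Y f
                 then Some (THE f. f \<in> extensional (points X) \<and> codes_map a X Y f)
                 else None) \<rparr>"

text \<open>In \<open>sierpinski\<close> the open point is \<open>True\<close>.\<close>

definition sierpinski :: "bool rspace" where
  "sierpinski = \<lparr> points = UNIV, rep = (\<lambda>p. Some (\<exists>n. p n \<noteq> 0)) \<rparr>"

text \<open>
  \<open>\<O>(X)\<close> is the function space from \<open>X\<close> into Sierpinski space, with each function
  identified with the set on which it is \<open>True\<close>.
\<close>

definition opens_rspace :: "'a rspace \<Rightarrow> 'a set rspace" where
  "opens_rspace X =
    (let set_of = (\<lambda>f. {x \<in> points X. f x}) in
     \<lparr> points = set_of ` points (fun_rspace X sierpinski),
       rep = map_option set_of \<circ> rep (fun_rspace X sierpinski) \<rparr>)"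

definition nhds_map :: "'a rspace \<Rightarrow> 'a \<Rightarrow> 'a set set" where
  "nhds_map X x = {U \<in> points (opens_rspace X). x \<in> U}"

definition admissible :: "'a rspace \<Rightarrow> bool" where
  "admissible X \<longleftrightarrow>
     (\<exists>g. (\<forall>x \<in> points X. g (nhds_map X x) = x) \<and>
          rcontinuous (subrspace (opens_rspace (opens_rspace X)) (nhds_map X ` points X)) X g)"


section \<open>Noetherian quasi-Polish spaces\<close>

definition final_topology :: "'a rspace \<Rightarrow> 'a topology" where
  "final_topology X =
     topology (\<lambda>U. U \<subseteq> points X \<and> openin (top_of_set (names X)) {p \<in> names X. the (rep X p) \<in> U})"

lemma openin_final_topology:
  "openin (final_topology X) U \<longleftrightarrow>
     U \<subseteq> points X \<and> openin (top_of_set (names X)) {p \<in> names X. the (rep X p) \<in> U}"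
proof -
  let ?pre = "\<lambda>U. {p \<in> names X. the (rep X p) \<in> U}"
  have int: "?pre (S \<inter> T) = ?pre S \<inter> ?pre T" for S T by auto
  have un: "?pre (\<Union>K) = \<Union>(?pre ` K)" for K by auto
  have "istopology (\<lambda>U. U \<subseteq> points X \<and> openin (top_of_set (names X)) (?pre U))"
    unfolding istopology_def int un by blast
  then show ?thesis
    unfolding final_topology_def by (simp add: topology_inverse')
qed

lemma quotient_map_final_topology:
  assumes "represented_space X"
  shows "quotient_map (top_of_set (names X)) (final_topology X) (the \<circ> rep X)"
proof -
  have im: "(the \<circ> rep X) ` names X = points X"
    using assms by (force simp: represented_space_def ran_def dom_def image_def)
  then have "{p \<in> names X. the (rep X p) \<in> points X} = names X" by auto
  then have "openin (final_topology X) (points X)"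
    unfolding openin_final_topology by simp
  then have "topspace (final_topology X) = points X"
    by (metis openin_final_topology openin_subset openin_topspace subset_antisym)
  then show ?thesis
    using im by (simp add: quotient_map_def openin_final_topology)
qed

text \<open>
  A quasi-Polish space, as a represented space, comes with a total, open and admissible
  representation; the underlying topological space is \<open>final_topology X\<close>.
\<close>

definition quasi_Polish :: "'a rspace \<Rightarrow> bool" where
  "quasi_Polish X \<longleftrightarrow>
     represented_space X \<and> names X = UNIV \<and>
     open_map (top_of_set (names X)) (final_topology X) (the \<circ> rep X) \<and> admissible X"

definition Noetherian :: "'a topology \<Rightarrow> bool" where
  "Noetherian T \<longleftrightarrow> \<not> (\<exists>U :: nat \<Rightarrow> 'a set. (\<forall>n. openin T (U n)) \<and> (\<forall>n. U n \<subset> U (Suc n)))"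


section \<open>Formulas\<close>

text \<open>
  The typing of variables is a function \<open>\<Gamma>\<close> assigning a represented space to each variable.
  Spaces used together have their points in a common type \<open>'a\<close>, and since \<open>points\<close>
  is an arbitrary subset of it, distinct variables can range over unrelated spaces.
\<close>

datatype ('v, 'a) formula =
    Atom "'a list set" "'v list"
  | Neg "('v, 'a) formula"
  | Conj "('v, 'a) formula" "('v, 'a) formula"
  | Disj "('v, 'a) formula" "('v, 'a) formula"
  | All 'v "('v, 'a) formula"
  | Ex 'v "('v, 'a) formula"

primrec free_vars :: "('v, 'a) formula \<Rightarrow> 'v set" where
  "free_vars (Atom R xs) = set xs"
| "free_vars (Neg \<phi>) = free_vars \<phi>"
| "free_vars (Conj \<phi> \<psi>) = free_vars \<phi> \<union> free_vars \<psi>"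
| "free_vars (Disj \<phi> \<psi>) = free_vars \<phi> \<union> free_vars \<psi>"
| "free_vars (All x \<phi>) = free_vars \<phi> - {x}"
| "free_vars (Ex x \<phi>) = free_vars \<phi> - {x}"

primrec well_formed :: "('v \<Rightarrow> 'a rspace) \<Rightarrow> ('v, 'a) formula \<Rightarrow> bool" where
  "well_formed \<Gamma> (Atom R xs) \<longleftrightarrow> Delta02 (prod_rspace (map \<Gamma> xs)) R"
| "well_formed \<Gamma> (Neg \<phi>) \<longleftrightarrow> well_formed \<Gamma> \<phi>"
| "well_formed \<Gamma> (Conj \<phi> \<psi>) \<longleftrightarrow> well_formed \<Gamma> \<phi> \<and> well_formed \<Gamma> \<psi>"
| "well_formed \<Gamma> (Disj \<phi> \<psi>) \<longleftrightarrow> well_formed \<Gamma> \<phi> \<and> well_formed \<Gamma> \<psi>"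
| "well_formed \<Gamma> (All x \<phi>) \<longleftrightarrow>
     quasi_Polish (\<Gamma> x) \<and> Noetherian (final_topology (\<Gamma> x)) \<and> well_formed \<Gamma> \<phi>"
| "well_formed \<Gamma> (Ex x \<phi>) \<longleftrightarrow>
     quasi_Polish (\<Gamma> x) \<and> Noetherian (final_topology (\<Gamma> x)) \<and> well_formed \<Gamma> \<phi>"

primrec sat :: "('v \<Rightarrow> 'a rspace) \<Rightarrow> ('v \<Rightarrow> 'a) \<Rightarrow> ('v, 'a) formula \<Rightarrow> bool" where
  "sat \<Gamma> \<sigma> (Atom R xs) \<longleftrightarrow> map \<sigma> xs \<in> R"
| "sat \<Gamma> \<sigma> (Neg \<phi>) \<longleftrightarrow> \<not> sat \<Gamma> \<sigma> \<phi>"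
| "sat \<Gamma> \<sigma> (Conj \<phi> \<psi>) \<longleftrightarrow> sat \<Gamma> \<sigma> \<phi> \<and> sat \<Gamma> \<sigma> \<psi>"
| "sat \<Gamma> \<sigma> (Disj \<phi> \<psi>) \<longleftrightarrow> sat \<Gamma> \<sigma> \<phi> \<or> sat \<Gamma> \<sigma> \<psi>"
| "sat \<Gamma> \<sigma> (All x \<phi>) \<longleftrightarrow> (\<forall>a \<in> points (\<Gamma> x). sat \<Gamma> (\<sigma>(x := a)) \<phi>)"
| "sat \<Gamma> \<sigma> (Ex x \<phi>) \<longleftrightarrow> (\<exists>a \<in> points (\<Gamma> x). sat \<Gamma> (\<sigma>(x := a)) \<phi>)"

text \<open>The relation on the variables \<open>ys\<close> (assumed distinct) defined by a formula.\<close>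

definition defined_set :: "('v \<Rightarrow> 'a rspace) \<Rightarrow> 'v list \<Rightarrow> ('v, 'a) formula \<Rightarrow> 'a list set" where
  "defined_set \<Gamma> ys \<phi> =
     {as \<in> points (prod_rspace (map \<Gamma> ys)). sat \<Gamma> (the \<circ> map_of (zip ys as)) \<phi>}"

end

theory Submission
  imports Defs
begin

text \<open>
  A subset is \<open>\<Delta>\<^sup>0\<^sub>2\<close> iff the set of names is a countable union of relatively closed sets on which
  membership is constant; this form is stable under boolean operations and continuous
  preimages. For a universal quantifier over a Noetherian quasi-Polish space with total open
  representation \<open>\<delta>\<close>, one shows by Noetherian induction on the open set \<open>V\<close>, from large to
  small, that \<open>\<forall>q. \<delta> q \<notin> V \<longrightarrow> A (p, q)\<close> has this form. By the Baire category theorem on the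
  closed set \<open>- \<delta> -` V\<close>, for every \<open>p\<close> one of the closed pieces for \<open>A\<close> contains all \<open>(p, q)\<close>
  with \<open>q\<close> in a nonempty relatively open part \<open>B - \<delta> -` V\<close>. Fixing \<open>B\<close> and the piece is a closed
  condition on \<open>p\<close>, on which the truth value of \<open>A\<close> is known for \<open>\<delta> q \<in> \<delta> ` B - V\<close>, so that only
  the larger open set \<open>V \<union> \<delta> ` B\<close> remains to be treated. The case \<open>V = {}\<close> is the quantifier.
\<close>

section \<open>Countable closed covers with constant pieces\<close>

text \<open>For two-valued \<open>f\<close> this means that both level sets are countable unions of
  relatively closed sets. The pieces may overlap, so covers can be refined and pooled freely. The
  domain type is left open because names, pairs of names and families of names all occur.\<close>

definition delta2_on :: "'t::topological_space set \<Rightarrow> ('t \<Rightarrow> 'b) \<Rightarrow> bool" where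
  "delta2_on S f \<longleftrightarrow>
     (\<exists>\<C>. countable \<C> \<and> \<Union>\<C> = S \<and> (\<forall>C\<in>\<C>. closedin (top_of_set S) C \<and> f constant_on C))"

lemma delta2_onI:
  assumes "countable \<C>" "\<Union>\<C> = S" "\<And>C. C \<in> \<C> \<Longrightarrow> closedin (top_of_set S) C"
    "\<And>C. C \<in> \<C> \<Longrightarrow> f constant_on C"
  shows "delta2_on S f"
  using assms unfolding delta2_on_def by blast

lemma delta2_onE:
  assumes "delta2_on S f"
  obtains \<C> where "countable \<C>" "\<Union>\<C> = S" "\<And>C. C \<in> \<C> \<Longrightarrow> closedin (top_of_set S) C"
    "\<And>C. C \<in> \<C> \<Longrightarrow> f constant_on C"
  using assms unfolding delta2_on_def by blast

lemma delta2_on_cong: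
  assumes "delta2_on S f" "\<And>x. x \<in> S \<Longrightarrow> f x = g x"
  shows "delta2_on S g"
proof -
  obtain \<C> where C: "countable \<C>" "\<Union>\<C> = S" "\<And>C. C \<in> \<C> \<Longrightarrow> closedin (top_of_set S) C"
    "\<And>C. C \<in> \<C> \<Longrightarrow> f constant_on C"
    using delta2_onE[OF assms(1)] by metis
  show ?thesis
  proof (rule delta2_onI[OF C(1-3)])
    fix C assume "C \<in> \<C>"
    then have "\<forall>x\<in>C. f x = g x" "f constant_on C" using C(2,4) assms(2) by auto
    then show "g constant_on C" unfolding constant_on_def by metis
  qed
qed

lemma delta2_on_const: "delta2_on S (\<lambda>x. c)"
  by (rule delta2_onI[of "{S}"]) (auto simp: constant_on_def)

lemma delta2_on_compose:
  assumes "delta2_on S f"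
  shows "delta2_on S (\<lambda>x. h (f x))"
proof -
  obtain \<C> where C: "countable \<C>" "\<Union>\<C> = S" "\<And>C. C \<in> \<C> \<Longrightarrow> closedin (top_of_set S) C"
    "\<And>C. C \<in> \<C> \<Longrightarrow> f constant_on C"
    using delta2_onE[OF assms] by metis
  show ?thesis
    by (rule delta2_onI[OF C(1-3)]) (use C(4) constant_on_compose[of f _ h] in \<open>auto simp: comp_def\<close>)
qed

lemma delta2_on_preimage:
  assumes "delta2_on S f" "continuous_on T h" "h \<in> T \<rightarrow> S"
  shows "delta2_on T (\<lambda>x. f (h x))"
proof -
  obtain \<C> where C: "countable \<C>" "\<Union>\<C> = S" "\<And>C. C \<in> \<C> \<Longrightarrow> closedin (top_of_set S) C"
    "\<And>C. C \<in> \<C> \<Longrightarrow> f constant_on C"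
    using delta2_onE[OF assms(1)] by metis
  show ?thesis
  proof (rule delta2_onI[of "(\<lambda>C. T \<inter> h -` C) ` \<C>"])
    show "countable ((\<lambda>C. T \<inter> h -` C) ` \<C>)" using C(1) by simp
    show "\<Union> ((\<lambda>C. T \<inter> h -` C) ` \<C>) = T" using C(2) assms(3) by auto
  next
    fix D assume "D \<in> (\<lambda>C. T \<inter> h -` C) ` \<C>"
    then obtain C' where D: "D = T \<inter> h -` C'" "C' \<in> \<C>" by auto
    show "closedin (top_of_set T) D"
      unfolding D(1) using continuous_closedin_preimage_gen[OF assms(2,3) C(3)[OF D(2)]] .
    show "(\<lambda>x. f (h x)) constant_on D"
      using C(4)[OF D(2)] by (auto simp: D(1) constant_on_def)
  qed
qed

lemma delta2_on_subset:
  assumes "delta2_on S f" "T \<subseteq> S"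
  shows "delta2_on T f"
  using delta2_on_preimage[OF assms(1), of T "\<lambda>x. x"] assms(2) by auto

text \<open>Sets closed in a closed piece are closed in \<open>S\<close>, so the covers of the
  pieces can be pooled. Thus \<open>f\<close> may be simplified separately on each piece.\<close>

lemma delta2_on_countable_closed_cover:
  assumes "countable \<D>" "\<Union>\<D> = S" "\<And>D. D \<in> \<D> \<Longrightarrow> closedin (top_of_set S) D"
    "\<And>D. D \<in> \<D> \<Longrightarrow> delta2_on D f"
  shows "delta2_on S f"
proof -
  have "\<forall>D\<in>\<D>. \<exists>\<C>. countable \<C> \<and> \<Union>\<C> = D \<and>
      (\<forall>C\<in>\<C>. closedin (top_of_set D) C \<and> f constant_on C)"
    using assms(4) unfolding delta2_on_def by blast
  then obtain \<C> where C: "\<forall>D\<in>\<D>. countable (\<C> D) \<and> \<Union>(\<C> D) = D \<and>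
      (\<forall>C\<in>\<C> D. closedin (top_of_set D) C \<and> f constant_on C)"
    by (rule bchoice[THEN exE])
  show ?thesis
  proof (rule delta2_onI[of "\<Union>(\<C> ` \<D>)"])
    show "countable (\<Union>(\<C> ` \<D>))" using assms(1) C by auto
    have "\<Union>(\<Union>(\<C> ` \<D>)) = (\<Union>D\<in>\<D>. \<Union>(\<C> D))" by blast
    also have "\<dots> = (\<Union>D\<in>\<D>. D)" using C by (intro SUP_cong) auto
    finally show "\<Union>(\<Union>(\<C> ` \<D>)) = S" using assms(2) by simp
  next
    fix K assume "K \<in> \<Union>(\<C> ` \<D>)"
    then obtain D where D: "D \<in> \<D>" "K \<in> \<C> D" by auto
    show "closedin (top_of_set S) K"
      by (rule closedin_trans[OF _ assms(3)[OF D(1)]]) (use C D in auto)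
    show "f constant_on K" using C D by auto
  qed
qed

lemma delta2_on_binop:
  assumes "delta2_on S f" "delta2_on S g"
  shows "delta2_on S (\<lambda>x. h (f x) (g x))"
proof -
  obtain \<C> where C: "countable \<C>" "\<Union>\<C> = S" "\<And>C. C \<in> \<C> \<Longrightarrow> closedin (top_of_set S) C"
    "\<And>C. C \<in> \<C> \<Longrightarrow> f constant_on C"
    using delta2_onE[OF assms(1)] by metis
  show ?thesis
  proof (rule delta2_on_countable_closed_cover[OF C(1-3)])
    fix C assume "C \<in> \<C>"
    then obtain c where c: "\<forall>x\<in>C. f x = c" using C(4) unfolding constant_on_def by metis
    have "delta2_on C g" using delta2_on_subset[OF assms(2)] C(2) \<open>C \<in> \<C>\<close> by blast
    from delta2_on_compose[OF this, of "h c"]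
    show "delta2_on C (\<lambda>x. h (f x) (g x))"
      by (rule delta2_on_cong) (use c in auto)
  qed
qed

section \<open>Baire category, closed sections and Noetherian induction\<close>

lemma completely_metrizable_space_baire: "completely_metrizable_space (euclidean :: baire topology)"
proof -
  have "(euclidean :: nat topology) = discrete_topology UNIV"
    by (simp add: topology_eq open_discrete flip: open_openin)
  then have "completely_metrizable_space (product_topology (\<lambda>_. euclidean :: nat topology) (UNIV :: nat set))"
    by (simp add: completely_metrizable_space_product_topology
        completely_metrizable_space_discrete_topology)
  then show ?thesis by (simp add: euclidean_product_topology)
qed

text \<open>\<open>Z\<close> is completely metrizable in its own right, hence not a countable union
  of closed sets with empty interior relative to \<open>Z\<close>. Taking \<open>B\<close> from a
  basis, later a countable one, leaves only countably many outcomes.\<close>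

lemma closed_countable_cover_local:
  fixes Z :: "baire set"
  assumes "topological_basis \<B>" "closed Z" "Z \<noteq> {}" "countable \<C>"
    "\<And>C. C \<in> \<C> \<Longrightarrow> closed C" "Z \<subseteq> \<Union>\<C>"
  obtains B C where "B \<in> \<B>" "C \<in> \<C>" "Z \<inter> B \<noteq> {}" "Z \<inter> B \<subseteq> C"
proof -
  let ?X = "top_of_set Z"
  have X: "completely_metrizable_space ?X"
    using assms(2) completely_metrizable_space_closedin completely_metrizable_space_baire
    by (metis closed_closedin)
  have "\<exists>C\<in>\<C>. ?X interior_of (Z \<inter> C) \<noteq> {}"
  proof (rule ccontr)
    assume *: "\<not> ?thesis"
    have "?X interior_of \<Union>((\<inter>) Z ` \<C>) = {}"
      by (rule Baire_category_alt) (use X assms(4,5) * in \<open>auto intro: closedin_closed_Int\<close>)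
    moreover have "\<Union>((\<inter>) Z ` \<C>) = topspace ?X" using assms(6) by auto
    ultimately show False using assms(3) by (metis interior_of_topspace topspace_euclidean_subtopology)
  qed
  then obtain C U where C: "C \<in> \<C>" "openin ?X U" "U \<noteq> {}" "U \<subseteq> Z \<inter> C"
    by (metis interior_of_subset openin_interior_of)
  then obtain T x where T: "open T" "U = Z \<inter> T" "x \<in> U" unfolding openin_open by blast
  then obtain B where "B \<in> \<B>" "x \<in> B" "B \<subseteq> T"
    using topological_basisE[OF assms(1), of T x] by blast
  then show ?thesis using that[of B C] C T by blast
qed

lemma closedin_section_all:
  assumes "closedin (top_of_set (S \<times> UNIV)) C"
  shows "closedin (top_of_set S) {p \<in> S. \<forall>q\<in>Q. (p, q) \<in> C}"
\<comment> \<open>The intersection over an empty \<open>Q\<close> would be \<open>UNIV\<close>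
  instead of \<open>S\<close>.\<close>
proof (cases "Q = {}")
  case False
  have "closedin (top_of_set S) (S \<inter> (\<lambda>p. (p, q)) -` C)" for q
    by (rule continuous_closedin_preimage_gen[OF _ _ assms]) (auto intro!: continuous_intros)
  then have "closedin (top_of_set S) (\<Inter>q\<in>Q. S \<inter> (\<lambda>p. (p, q)) -` C)"
    using False by blast
  moreover have "(\<Inter>q\<in>Q. S \<inter> (\<lambda>p. (p, q)) -` C) = {p \<in> S. \<forall>q\<in>Q. (p, q) \<in> C}"
    using False by auto
  ultimately show ?thesis by simp
qed simp

text \<open>The larger set comes first in each pair: descending in the relation means ascending
  among open sets, so induction provides the claim for all larger open sets.\<close>

lemma Noetherian_wf:
  assumes "Noetherian T"
  shows "wf {(V, U). openin T U \<and> openin T V \<and> U \<subset> V}"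
  unfolding wf_iff_no_infinite_down_chain
proof
  assume "\<exists>f. \<forall>i. (f (Suc i), f i) \<in> {(V, U). openin T U \<and> openin T V \<and> U \<subset> V}"
  then obtain f where f: "\<forall>i. (f (Suc i), f i) \<in> {(V, U). openin T U \<and> openin T V \<and> U \<subset> V}"
    by (rule exE)
  have "\<exists>U :: nat \<Rightarrow> _. (\<forall>n. openin T (U n)) \<and> (\<forall>n. U n \<subset> U (Suc n))"
    by (rule exI[of _ f]) (use f in simp)
  with assms show False unfolding Noetherian_def by (rule notE)
qed

section \<open>Quantification over a Noetherian quasi-Polish space\<close>

lemma points_eq_image_rep:
  assumes "represented_space X"
  shows "points X = (the \<circ> rep X) ` names X"
  using assms unfolding represented_space_def by (force simp: ran_def)

lemma topspace_final_topology:
  assumes "represented_space X"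
  shows "topspace (final_topology X) = points X"
  using quotient_map_final_topology[OF assms] points_eq_image_rep[OF assms]
  by (simp add: quotient_map_def)

text \<open>Quantifying over names \<open>q\<close> instead of points brings in Baire space, where
  the category theorem applies. By \<open>ext\<close> only the named point matters, which carries a
  value found on a basic set of names over to all names of the same points.\<close>

lemma delta2_on_All:
  fixes A :: "'t::topological_space \<times> baire \<Rightarrow> bool" and X :: "'a rspace"
  assumes qp: "quasi_Polish X" and noeth: "Noetherian (final_topology X)"
    and A: "delta2_on (S \<times> UNIV) A"
    and ext: "\<And>p q q'. p \<in> S \<Longrightarrow> rep X q = rep X q' \<Longrightarrow> A (p, q) = A (p, q')"
  shows "delta2_on S (\<lambda>p. \<forall>q. A (p, q))"
proof -
  let ?T = "final_topology X"
  define \<delta> where "\<delta> = the \<circ> rep X"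
  have rs: "represented_space X" and dom: "names X = UNIV"
    and op: "open_map euclidean ?T \<delta>"
    using qp unfolding quasi_Polish_def by (auto simp: \<delta>_def)
  have rep: "rep X q = Some (\<delta> q)" for q
    using dom by (metis UNIV_I \<delta>_def comp_apply domD option.sel)
  have pts: "range \<delta> = points X"
    using points_eq_image_rep[OF rs] dom unfolding \<delta>_def by simp
  have cont: "open (\<delta> -` V)" if "openin ?T V" for V
  proof -
    have "\<delta> -` V = {p. the (rep X p) \<in> V}" by (auto simp: \<delta>_def)
    then show ?thesis using that unfolding openin_final_topology dom by simp
  qed
  obtain \<C> where C: "countable \<C>" "\<Union>\<C> = S \<times> UNIV"
    "\<And>C. C \<in> \<C> \<Longrightarrow> closedin (top_of_set (S \<times> UNIV)) C" "\<And>C. C \<in> \<C> \<Longrightarrow> A constant_on C"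
    using delta2_onE[OF A] by metis
  obtain \<B> :: "baire set set" where B: "countable \<B>" "topological_basis \<B>"
    using ex_countable_basis by metis
  have "delta2_on S (\<lambda>p. \<forall>q. \<delta> q \<notin> V \<longrightarrow> A (p, q))" if "openin ?T V" for V
    using Noetherian_wf[OF noeth] that
  proof (induction V rule: wf_induct_rule)
    case (less V)
    \<comment> \<open>If \<open>V\<close> is the whole space, the quantifier is vacuous. Otherwise
      \<open>Z\<close> is nonempty, as the category argument requires.\<close>
    show ?case
    proof (cases "V = points X")
      case True
      then have "(\<lambda>p. \<forall>q. \<delta> q \<notin> V \<longrightarrow> A (p, q)) = (\<lambda>p. True)" using pts by auto
      then show ?thesis using delta2_on_const by metis
    next
      case False
      define Z where "Z = - (\<delta> -` V)"
      have "V \<subseteq> range \<delta>" "V \<noteq> range \<delta>"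
        using False openin_subset[OF less.prems] topspace_final_topology[OF rs] pts by auto
      then have Z: "closed Z" "Z \<noteq> {}"
        using cont[OF less.prems] unfolding Z_def by auto
      \<comment> \<open>\<open>K (B, C)\<close> holds the parameters for which the category argument
        succeeds with \<open>B\<close> and \<open>C\<close>. Pairs with \<open>Z \<inter> B\<close>
        empty are excluded: every \<open>p\<close> would satisfy their condition, but
        \<open>V\<close> would not grow.\<close>
      define P where "P = {(B, C). B \<in> \<B> \<and> C \<in> \<C> \<and> Z \<inter> B \<noteq> {}}"
      define K where "K = (\<lambda>(B, C). {p \<in> S. \<forall>q\<in>Z \<inter> B. (p, q) \<in> C})"
      show ?thesis
      proof (rule delta2_on_countable_closed_cover[of "K ` P"])
        have "P \<subseteq> \<B> \<times> \<C>" unfolding P_def by auto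
        then show "countable (K ` P)"
          using B(1) C(1) by (meson countable_SIGMA countable_image countable_subset)
        have "\<exists>b\<in>P. p \<in> K b" if "p \<in> S" for p
        proof -
          \<comment> \<open>For \<open>p\<close> in \<open>S\<close> the sections of the pieces at
            \<open>p\<close> are closed and cover Baire space, in particular
            \<open>Z\<close>.\<close>
          let ?sec = "(\<lambda>C. Pair p -` C)"
          have sec: "closed (?sec C)" if "C \<in> \<C>" for C
          proof -
            have "closedin (top_of_set UNIV) (UNIV \<inter> Pair p -` C)"
              by (rule continuous_closedin_preimage_gen[OF _ _ C(3)[OF that]])
                (use \<open>p \<in> S\<close> in \<open>auto intro!: continuous_intros\<close>)
            then show ?thesis by simp
          qed
          have "Z \<subseteq> \<Union>(?sec ` \<C>)" using C(2) that by auto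
          then obtain B' C'
            where "B' \<in> \<B>" "C' \<in> ?sec ` \<C>" "Z \<inter> B' \<noteq> {}" "Z \<inter> B' \<subseteq> C'"
            by (rule closed_countable_cover_local[OF B(2) Z countable_image[OF C(1)], rotated])
              (use sec in auto)
          then show ?thesis using that unfolding P_def K_def by auto
        qed
        then show "\<Union>(K ` P) = S" unfolding K_def by fastforce
      next
        fix D assume "D \<in> K ` P"
        then obtain B' C' where D: "D = {p \<in> S. \<forall>q\<in>Z \<inter> B'. (p, q) \<in> C'}"
          and BC: "B' \<in> \<B>" "C' \<in> \<C>" "Z \<inter> B' \<noteq> {}"
          unfolding P_def K_def by auto
        show "closedin (top_of_set S) D"
          unfolding D by (rule closedin_section_all[OF C(3)[OF BC(2)]])
        obtain c where c: "\<And>x. x \<in> C' \<Longrightarrow> A x = c"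
          using C(4)[OF BC(2)] unfolding constant_on_def by metis
        let ?V = "V \<union> \<delta> ` B'"
        \<comment> \<open>Here the openness of the representation enters. The union with
          \<open>V\<close> is strictly larger than \<open>V\<close>, since a name in
          \<open>Z \<inter> B'\<close> denotes a point outside \<open>V\<close>.\<close>
        have "openin ?T (\<delta> ` B')"
          using op topological_basis_open[OF B(2) BC(1)] unfolding open_map_def by auto
        then have "openin ?T ?V" using less.prems by blast
        moreover have "V \<subset> ?V" using BC(3) unfolding Z_def by auto
        ultimately have "delta2_on S (\<lambda>p. \<forall>q. \<delta> q \<notin> ?V \<longrightarrow> A (p, q))"
          using less.prems by (intro less.IH CollectI case_prodI conjI)
        then have "delta2_on D (\<lambda>p. \<forall>q. \<delta> q \<notin> ?V \<longrightarrow> A (p, q))"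
          by (rule delta2_on_subset) (auto simp: D)
        from delta2_on_compose[OF this, of "\<lambda>b. c \<and> b"]
        show "delta2_on D (\<lambda>p. \<forall>q. \<delta> q \<notin> V \<longrightarrow> A (p, q))"
        proof (rule delta2_on_cong)
          fix p assume p: "p \<in> D"
          have Ac: "A (p, q) = c" if "q \<in> Z" "q \<in> B'" for q
            using that p c unfolding D by auto
          \<comment> \<open>\<open>q\<close> itself may lie outside \<open>B'\<close>. It shares its
            point with some \<open>q'\<close> in \<open>B'\<close>, which is again in
            \<open>Z\<close> because \<open>Z\<close> is a union of fibres of
            \<open>\<delta>\<close>.\<close>
          have Ac': "A (p, q) = c" if q: "q \<in> Z" "\<delta> q \<in> \<delta> ` B'" for q
          proof -
            obtain q' where q': "q' \<in> B'" "\<delta> q = \<delta> q'" using q(2) by auto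
            then have "q' \<in> Z" using q(1) unfolding Z_def by auto
            moreover have "rep X q = rep X q'" using q'(2) by (simp only: rep)
            then have "A (p, q) = A (p, q')" using p by (intro ext) (simp_all add: D)
            ultimately show ?thesis using Ac[of q'] q'(1) by simp
          qed
          \<comment> \<open>This instance makes \<open>c\<close> a necessary condition for the
            quantified statement.\<close>
          obtain q0 where "q0 \<in> Z" "q0 \<in> B'" using BC(3) by blast
          then have q0: "\<delta> q0 \<notin> V" "A (p, q0) = c" using Ac unfolding Z_def by auto
          have cases: "A (p, q) = c \<or> \<delta> q \<notin> ?V" if "\<delta> q \<notin> V" for q
            using Ac'[of q] that unfolding Z_def by auto
          show "(c \<and> (\<forall>q. \<delta> q \<notin> ?V \<longrightarrow> A (p, q))) = (\<forall>q. \<delta> q \<notin> V \<longrightarrow> A (p, q))"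
          proof
            assume "c \<and> (\<forall>q. \<delta> q \<notin> ?V \<longrightarrow> A (p, q))"
            then show "\<forall>q. \<delta> q \<notin> V \<longrightarrow> A (p, q)" using cases by metis
          next
            assume "\<forall>q. \<delta> q \<notin> V \<longrightarrow> A (p, q)"
            then show "c \<and> (\<forall>q. \<delta> q \<notin> ?V \<longrightarrow> A (p, q))" using q0 by auto
          qed
        qed
      qed
    qed
  qed
  from this[of "{}"] show ?thesis by simp
qed

section \<open>Equivalence with realizability into the jump of the two-point space\<close>

lemma closed_coordinate: "closed {r :: 'i \<Rightarrow> 'b::discrete_topology. P (r i)}"
proof -
  have "closed ((\<lambda>r :: 'i \<Rightarrow> 'b. r i) -` Collect P)"
    by (rule closed_vimage) (auto simp: closed_def open_discrete)
  then show ?thesis by (simp add: vimage_def)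
qed

lemma Delta_eq_SomeD:
  assumes "Delta p = Some r"
  shows "r 0 = p (after_zeros p) - 1" "\<And>i. i \<ge> after_zeros p \<Longrightarrow> p i \<noteq> 0"
    "after_zeros p = 0 \<or> p (after_zeros p - 1) = 0"
proof -
  have fin: "finite {i. p i = 0}" and r: "r = (\<lambda>n. p (n + after_zeros p) - 1)"
    using assms unfolding Delta_def by (auto split: if_splits)
  show "r 0 = p (after_zeros p) - 1" by (simp add: r)
  show "p i \<noteq> 0" if "i \<ge> after_zeros p" for i
  proof
    assume "p i = 0"
    then have "i \<le> Max {i. p i = 0}" "after_zeros p = Suc (Max {i. p i = 0})"
      using Max_ge[OF fin, of i] unfolding after_zeros_def by auto
    then show False using that by simp
  qed
  show "after_zeros p = 0 \<or> p (after_zeros p - 1) = 0"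
  proof (cases "{i. p i = 0} = {}")
    case True
    then show ?thesis unfolding after_zeros_def by simp
  next
    case False
    then show ?thesis using Max_in[OF fin False] unfolding after_zeros_def by simp
  qed
qed

text \<open>Converse to the last two facts of \<open>Delta_eq_SomeD\<close>: the position after the
  last zero is described by conditions on single entries, which define a closed set.\<close>

lemma after_zeros_eqI:
  assumes "n = 0 \<or> p (n - 1) = 0" "\<And>i. i \<ge> n \<Longrightarrow> p i \<noteq> 0"
  shows "after_zeros p = n"
proof -
  have le: "{i. p i = 0} \<subseteq> {..<n}" using assms(2) not_less by blast
  then have fin: "finite {i. p i = 0}" by (rule finite_subset) simp
  show ?thesis
  proof (cases "n = 0")
    case True
    then show ?thesis using le unfolding after_zeros_def by auto
  next
    case False
    then have last: "n - 1 \<in> {i. p i = 0}" using assms(1) by simp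
    have "Max {i. p i = 0} = n - 1"
    proof (rule Max_eqI[OF fin _ last])
      fix i assume "i \<in> {i. p i = 0}"
      then have "i < n" using le by blast
      then show "i \<le> n - 1" by simp
    qed
    then show ?thesis using False last unfolding after_zeros_def by auto
  qed
qed

lemma rep_nabla_two:
  "rep (nabla two_rspace) p = Some v \<longleftrightarrow>
     finite {i. p i = 0} \<and> v = p (after_zeros p) - 1 \<and> v \<in> {0, 1}"
  unfolding nabla_def two_rspace_def Delta_def by (auto simp: map_comp_def)

text \<open>The outputs of a realizer are sorted by the position \<open>n\<close> after the last
  zero and the entry \<open>v\<close> there. Each class is closed, and its preimage under the
  continuous realizer is a piece on which the answer is fixed.\<close>

lemma delta2_on_of_Delta02:
  assumes "Delta02 X A"
  shows "delta2_on (names X) (\<lambda>p. the (rep X p) \<in> A)"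
proof -
  obtain D F where F: "names X \<subseteq> D" "continuous_on D F"
    "\<And>p x. rep X p = Some x \<Longrightarrow> rep (nabla two_rspace) (F p) = Some (indicator A x)"
    using assms unfolding Delta02_def rcontinuous_def by blast
  define K :: "nat \<times> nat \<Rightarrow> baire set" where
    "K = (\<lambda>(n, v). {r. (n = 0 \<or> r (n - 1) = 0) \<and> r n = v \<and> (\<forall>i. i \<ge> n \<longrightarrow> r i \<noteq> 0)})"
  have K: "closed (K (n, v))" for n v
    unfolding K_def prod.case
    by (intro closed_Collect_conj closed_Collect_disj closed_Collect_all closed_Collect_imp closed_coordinate) auto
  have az: "after_zeros r = n" if "r \<in> K (n, v)" for r n v
    using that by (intro after_zeros_eqI) (auto simp: K_def)
  have cont: "continuous_on (names X) F" using F continuous_on_subset by blast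
  show ?thesis
  proof (rule delta2_onI[of "range (\<lambda>b. names X \<inter> F -` K b)"])
    have "\<exists>b. F p \<in> K b" if p: "p \<in> names X" for p
    proof -
      obtain r where r: "Delta (F p) = Some r"
      proof -
        obtain x where "rep X p = Some x" using p by auto
        from F(3)[OF this] have "finite {i. F p i = 0}" unfolding rep_nabla_two by simp
        then show thesis using that unfolding Delta_def by simp
      qed
      have "F p \<in> K (after_zeros (F p), F p (after_zeros (F p)))"
        using Delta_eq_SomeD[OF r] unfolding K_def by auto
      then show ?thesis by blast
    qed
    then show "\<Union>(range (\<lambda>b. names X \<inter> F -` K b)) = names X" by blast
  next
    fix C assume "C \<in> range (\<lambda>b. names X \<inter> F -` K b)"
    then obtain n v where C: "C = names X \<inter> F -` K (n, v)" by auto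
    show "closedin (top_of_set (names X)) C"
      unfolding C by (rule continuous_closedin_preimage[OF cont K])
    \<comment> \<open>\<open>Delta\<close> subtracts 1 from the entries, so the entry 2 stands for
      truth.\<close>
    have "(the (rep X p) \<in> A) = (v - 1 = 1)" if p: "p \<in> C" for p
    proof -
      obtain x where x: "rep X p = Some x" using p C by auto
      have "after_zeros (F p) = n" "F p n = v" using az p unfolding C by (auto simp: K_def)
      then have "indicator A x = v - 1" using F(3)[OF x] unfolding rep_nabla_two by auto
      then show ?thesis using x by (cases "x \<in> A") auto
    qed
    then show "(\<lambda>p. the (rep X p) \<in> A) constant_on C" unfolding constant_on_def by blast
  qed simp
qed

lemma open_cylinder: "open {q :: baire. \<forall>i<s. q i = p i}"
proof -
  have "open (\<Inter>i\<in>{..<s}. (\<lambda>q :: baire. q i) -` {p i})"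
    by (intro open_INT ballI open_vimage) (auto simp: open_discrete)
  moreover have "(\<Inter>i\<in>{..<s}. (\<lambda>q :: baire. q i) -` {p i}) = {q. \<forall>i<s. q i = p i}" by auto
  ultimately show ?thesis by simp
qed

text \<open>The preimage of any set of values of entry \<open>s\<close> is a union of cylinders. The
  realizer built below reads only \<open>s\<close> entries before producing entry
  \<open>s\<close>.\<close>

lemma continuous_on_finite_use:
  fixes F :: "baire \<Rightarrow> baire"
  assumes "\<And>p q s. (\<And>i. i < s \<Longrightarrow> p i = q i) \<Longrightarrow> F p s = F q s"
  shows "continuous_on UNIV F"
proof (rule continuous_on_coordinatewise_then_product)
  fix s
  have "open ((\<lambda>p. F p s) -` U)" for U :: "nat set"
  proof (subst open_subopen, intro ballI)
    fix p assume p: "p \<in> (\<lambda>p. F p s) -` U"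
    have "{q. \<forall>i<s. q i = p i} \<subseteq> (\<lambda>p. F p s) -` U"
    proof
      fix q assume "q \<in> {q. \<forall>i<s. q i = p i}"
      then have "F q s = F p s" by (intro assms) simp
      then show "q \<in> (\<lambda>p. F p s) -` U" using p by simp
    qed
    then show "\<exists>T. open T \<and> p \<in> T \<and> T \<subseteq> (\<lambda>p. F p s) -` U"
      using open_cylinder[of s p] by blast
  qed
  then show "continuous_on UNIV (\<lambda>p. F p s)"
    by (simp add: continuous_on_open_vimage)
qed

text \<open>A basic box around \<open>p\<close> constrains only finitely many coordinates, so any
  \<open>s\<close> beyond them works.\<close>

lemma open_contains_cylinder:
  assumes "open U" "p \<in> U"
  obtains s where "{q :: baire. \<forall>i<s. q i = p i} \<subseteq> U"
proof -
  obtain W where W: "p \<in> Pi\<^sub>E UNIV W" "\<And>i. open (W i)" "finite {i. W i \<noteq> UNIV}" "Pi\<^sub>E UNIV W \<subseteq> U"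
    using product_topology_open_contains_basis[of "\<lambda>_. euclidean" UNIV U p] assms
    unfolding open_fun_def by auto
  obtain s where s: "{i. W i \<noteq> UNIV} \<subseteq> {..<s}"
    using W(3) finite_nat_iff_bounded by metis
  have "q i \<in> W i" if "\<forall>i<s. q i = p i" for q i
  proof (cases "i < s")
    case True
    then show ?thesis using that W(1) by (simp add: PiE_iff)
  next
    case False
    then show ?thesis using s by auto
  qed
  then have "{q. \<forall>i<s. q i = p i} \<subseteq> Pi\<^sub>E UNIV W" by auto
  then show ?thesis using that W(4) by blast
qed

text \<open>
  The realizer outputs the value belonging to the least closed set not yet refuted by the
  finite part of the name read so far, and signals each change of this set by a zero.
\<close>

lemma Delta02_of_delta2_on:
  assumes "A \<subseteq> points X" "delta2_on (names X) (\<lambda>p. the (rep X p) \<in> A)"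
  shows "Delta02 X A"
proof -
  obtain \<C> where C: "countable \<C>" "\<Union>\<C> = names X"
    "\<And>C. C \<in> \<C> \<Longrightarrow> closedin (top_of_set (names X)) C"
    "\<And>C. C \<in> \<C> \<Longrightarrow> (\<lambda>p. the (rep X p) \<in> A) constant_on C"
    using delta2_onE[OF assms(2)] by metis
  \<comment> \<open>Adding the empty set makes the family nonempty, so that it can be enumerated
    even if there are no names. No name lies in the added set.\<close>
  define c where "c = from_nat_into (insert {} \<C>)"
  have range_c: "range c = insert {} \<C>"
    unfolding c_def using C(1) by (intro range_from_nat_into) auto
  define b where "b n \<longleftrightarrow> (\<exists>p\<in>c n. the (rep X p) \<in> A)" for n
  have b: "the (rep X p) \<in> A \<longleftrightarrow> b n" if "p \<in> c n" for p n
  proof -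
    have "c n \<in> \<C>" using range_c that by (metis empty_iff insertE rangeI)
    then show ?thesis using C(4) that unfolding b_def constant_on_def by metis
  qed
  have refuted: "\<exists>s. \<forall>q\<in>c n. \<exists>i<s. q i \<noteq> p i" if "p \<in> names X" "p \<notin> c n" for p n
  proof -
    have "closedin (top_of_set (names X)) (c n)"
      using C(3) range_c by (metis closedin_empty insertE rangeI)
    then obtain L where L: "closed L" "c n = names X \<inter> L" unfolding closedin_closed by blast
    then have "open (- L)" "p \<in> - L" using that by auto
    then obtain s where "{q. \<forall>i<s. q i = p i} \<subseteq> - L"
      by (rule open_contains_cylinder)
    then show ?thesis using L(2) by blast
  qed
  \<comment> \<open>The clause \<open>s \<le> n\<close> keeps some index alive at every stage, so
    the least one exists. Otherwise \<open>n\<close> is alive if the first \<open>s\<close> entries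
    of \<open>p\<close> extend to an element of \<open>c n\<close>.\<close>
  define alive where "alive p s n \<longleftrightarrow> s \<le> n \<or> (\<exists>q\<in>c n. \<forall>i<s. q i = p i)" for p s n
  define idx where "idx p s = (LEAST n. alive p s n)" for p s
  \<comment> \<open>Entries 2 and 1 become the truth values 1 and 0 once \<open>Delta\<close> has
    subtracted 1.\<close>
  define F :: "baire \<Rightarrow> baire" where
    "F p s = (if s > 0 \<and> idx p s \<noteq> idx p (s - 1) then 0 else if b (idx p s) then 2 else 1)" for p s
  have alive_idx: "alive p s (idx p s)" for p s
    unfolding idx_def by (rule LeastI[of "alive p s" s]) (simp add: alive_def)
  have "alive p s = alive q s" if "\<And>i. i < t \<Longrightarrow> p i = q i" "s \<le> t" for p q s t
  proof (rule ext)
    fix n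
    have "p i = q i" if "i < s" for i using that \<open>s \<le> t\<close> by (intro \<open>\<And>i. i < t \<Longrightarrow> p i = q i\<close>) simp
    then show "alive p s n = alive q s n" unfolding alive_def by simp
  qed
  then have idx_use: "idx p s = idx q s" if "\<And>i. i < t \<Longrightarrow> p i = q i" "s \<le> t" for p q :: baire and s t
    using that unfolding idx_def by metis
  have cont: "continuous_on UNIV F"
  proof (rule continuous_on_finite_use)
    fix p q :: baire and s assume eq: "\<And>i. i < s \<Longrightarrow> p i = q i"
    have "idx p s = idx q s" "idx p (s - 1) = idx q (s - 1)"
      by (auto intro!: idx_use[of s p q] simp: eq)
    then show "F p s = F q s" by (simp only: F_def)
  qed
  have "rep (nabla two_rspace) (F p) = Some (indicator A x)" if x: "rep X p = Some x" for p x
  proof -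
    have p: "p \<in> names X" using x by auto
    define N where "N = (LEAST n. p \<in> c n)"
    have "\<exists>n. p \<in> c n" using p C(2) range_c by (metis UnionE insertCI rangeE)
    then have N: "p \<in> c N" unfolding N_def by (rule LeastI_ex)
    have less_N: "p \<notin> c n" if "n < N" for n using that not_less_Least unfolding N_def by blast
    have idx_le: "idx p s \<le> N" for s
      unfolding idx_def by (rule Least_le) (use N in \<open>auto simp: alive_def\<close>)
    have "\<forall>n. \<exists>s. n < N \<longrightarrow> (\<forall>q\<in>c n. \<exists>i<s. q i \<noteq> p i)"
      using refuted[OF p] less_N by blast
    then obtain f where f: "\<And>n. n < N \<Longrightarrow> \<forall>q\<in>c n. \<exists>i<f n. q i \<noteq> p i" by metis
    \<comment> \<open>From stage \<open>t\<close> on, every index below \<open>N\<close> is refuted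
      by the prefix read so far, and \<open>N \<le> t\<close> ensures that the clause
      \<open>s \<le> n\<close> no longer protects it.\<close>
    define t where "t = Max (insert N (f ` {..<N}))"
    have t: "N \<le> t" "\<And>n. n < N \<Longrightarrow> f n \<le> t" unfolding t_def by auto
    have lim: "idx p s = N" if "t \<le> s" for s
    proof (rule ccontr)
      assume "idx p s \<noteq> N"
      then have lt: "idx p s < N" using idx_le[of s] by simp
      then have "\<not> s \<le> idx p s" using t(1) that by simp
      then obtain q where "q \<in> c (idx p s)" "\<forall>i<s. q i = p i"
        using alive_idx[of p s] unfolding alive_def by blast
      then show False using f[OF lt] t(2)[OF lt] that by (meson less_le_trans)
    qed
    have "{i. F p i = 0} \<subseteq> {..t}"
    proof
      fix i assume "i \<in> {i. F p i = 0}"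
      then have "idx p i \<noteq> idx p (i - 1)" by (auto simp: F_def split: if_splits)
      then have "\<not> t \<le> i - 1" using lim by (metis diff_le_self le_trans)
      then show "i \<in> {..t}" by simp
    qed
    then have fin: "finite {i. F p i = 0}" by (rule finite_subset) simp
    then obtain r where r: "Delta (F p) = Some r" unfolding Delta_def by auto
    define z where "z = after_zeros (F p)"
    have nz: "F p i \<noteq> 0" if "i \<ge> z" for i using Delta_eq_SomeD(2)[OF r] that unfolding z_def by simp
    \<comment> \<open>A change of index after \<open>z\<close> would produce a zero there, so the
      index at \<open>z\<close> is already the limit \<open>N\<close>.\<close>
    have "idx p z = idx p (z + k)" for k
    proof (induction k)
      case (Suc k)
      then show ?case using nz[of "z + Suc k"] by (auto simp: F_def split: if_splits)
    qed simp
    then have "idx p z = N" using lim by (metis le_add2)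
    then have "F p z = (if b N then 2 else 1)"
      using nz[of z] by (auto simp: F_def split: if_splits)
    then show ?thesis
      using b[OF N] x fin unfolding rep_nabla_two by (auto simp: z_def)
  qed
  then show ?thesis
    using cont assms(1) unfolding Delta02_def rcontinuous_def by blast
qed

section \<open>Evaluation of formulas on families of names\<close>

text \<open>A family assigns a sequence to every variable, but only those in \<open>V\<close> must
  receive names. Binding a variable is then a continuous update, and no tuples have to be reindexed
  in the induction on formulas.\<close>

definition env_names :: "('v \<Rightarrow> 'a rspace) \<Rightarrow> 'v set \<Rightarrow> ('v \<Rightarrow> baire) set" where
  "env_names \<Gamma> V = {P. \<forall>v\<in>V. P v \<in> names (\<Gamma> v)}"

definition env :: "('v \<Rightarrow> 'a rspace) \<Rightarrow> ('v \<Rightarrow> baire) \<Rightarrow> 'v \<Rightarrow> 'a" where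
  "env \<Gamma> P v = the (rep (\<Gamma> v) (P v))"

lemma rep_prod_rspace:
  assumes "\<And>i. i < length xs \<Longrightarrow> component (length xs) i p = P (xs ! i)"
    and "P \<in> env_names \<Gamma> (set xs)"
  shows "rep (prod_rspace (map \<Gamma> xs)) p = Some (map (env \<Gamma> P) xs)"
proof -
  have "map (\<lambda>i. the (rep (map \<Gamma> xs ! i) (component (length xs) i p))) [0..<length xs] =
      map (env \<Gamma> P) xs"
    by (rule nth_equalityI) (use assms(1) in \<open>auto simp: env_def\<close>)
  moreover have "\<forall>i<length xs. component (length xs) i p \<in> names (map \<Gamma> xs ! i)"
    using assms unfolding env_names_def by auto
  ultimately show ?thesis unfolding prod_rspace_def Let_def by auto
qed

lemma continuous_on_coordinate [continuous_intros]:
  "continuous_on S (\<lambda>x :: 'i \<Rightarrow> 'b::topological_space. x i)"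
  by (rule continuous_on_subset[OF continuous_on_product_coordinates]) simp

lemma delta2_on_Atom:
  fixes \<Gamma> :: "'v \<Rightarrow> 'a rspace"
  assumes "Delta02 (prod_rspace (map \<Gamma> xs)) R"
  shows "delta2_on (env_names \<Gamma> (set xs)) (\<lambda>P. map (env \<Gamma> P) xs \<in> R)"
proof -
  let ?m = "length xs"
  \<comment> \<open>\<open>h\<close> interleaves the names of the arguments and so inverts
    \<open>component\<close>; repeated variables are copied. For empty \<open>xs\<close> its values
    are irrelevant, since every sequence names the empty tuple.\<close>
  define h :: "('v \<Rightarrow> baire) \<Rightarrow> baire" where "h P k = P (xs ! (k mod ?m)) (k div ?m)" for P k
  have cont: "continuous_on S h" for S
  proof (rule continuous_on_coordinatewise_then_product)
    fix k
    show "continuous_on S (\<lambda>P. h P k)"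
      unfolding h_def
      by (rule continuous_on_compose2[of UNIV "\<lambda>r. r (k div ?m)" S "\<lambda>P. P (xs ! (k mod ?m))"])
        (auto intro: continuous_on_coordinate)
  qed
  have rep: "rep (prod_rspace (map \<Gamma> xs)) (h P) = Some (map (env \<Gamma> P) xs)"
    if "P \<in> env_names \<Gamma> (set xs)" for P
  proof (rule rep_prod_rspace[OF _ that])
    fix i assume "i < ?m"
    moreover from this have "(?m * n + i) div ?m = n" for n
      by (intro div_nat_eqI) auto
    ultimately show "component ?m i (h P) = P (xs ! i)"
      by (simp add: component_def h_def)
  qed
  have "delta2_on (env_names \<Gamma> (set xs)) (\<lambda>P. the (rep (prod_rspace (map \<Gamma> xs)) (h P)) \<in> R)"
    by (rule delta2_on_preimage[OF delta2_on_of_Delta02[OF assms] cont]) (use rep in auto)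
  then show ?thesis by (rule delta2_on_cong) (simp add: rep)
qed

lemma env_upd: "env \<Gamma> (P(x := q)) = (env \<Gamma> P)(x := the (rep (\<Gamma> x) q))"
  by (rule ext) (simp add: env_def)

lemma delta2_on_forall_point:
  assumes "quasi_Polish (\<Gamma> x)" "Noetherian (final_topology (\<Gamma> x))"
    and "delta2_on (env_names \<Gamma> V) (\<lambda>P. f (env \<Gamma> P))"
  shows "delta2_on (env_names \<Gamma> (V - {x})) (\<lambda>P. \<forall>a \<in> points (\<Gamma> x). f ((env \<Gamma> P)(x := a)))"
proof -
  have nm: "names (\<Gamma> x) = UNIV" and rs: "represented_space (\<Gamma> x)"
    using assms(1) unfolding quasi_Polish_def by auto
  have pts: "points (\<Gamma> x) = range (\<lambda>q. the (rep (\<Gamma> x) q))"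
    using points_eq_image_rep[OF rs] nm by (simp add: comp_def)
  let ?S = "env_names \<Gamma> (V - {x})"
  let ?A = "\<lambda>(P, q). f (env \<Gamma> (P(x := q)))"
  have cont: "continuous_on (?S \<times> UNIV) (\<lambda>(P, q). P(x := q))"
  proof (rule continuous_on_coordinatewise_then_product)
    fix v
    have "continuous_on (?S \<times> UNIV) (\<lambda>z. fst z v :: baire)"
      by (rule continuous_on_compose2[of UNIV "\<lambda>P. P v" _ fst])
        (auto intro: continuous_on_coordinate continuous_on_fst)
    then show "continuous_on (?S \<times> UNIV) (\<lambda>z. (case z of (P, q) \<Rightarrow> P(x := q)) v)"
      by (cases "v = x") (auto simp: case_prod_unfold intro: continuous_intros)
  qed
  have "delta2_on (?S \<times> UNIV) (\<lambda>z. f (env \<Gamma> ((\<lambda>(P, q). P(x := q)) z)))"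
    by (rule delta2_on_preimage[OF assms(3) cont]) (use nm in \<open>simp add: env_names_def case_prod_unfold mem_Times_iff\<close>)
  then have "delta2_on (?S \<times> UNIV) ?A" by (simp add: case_prod_unfold)
  then have "delta2_on ?S (\<lambda>P. \<forall>q. ?A (P, q))"
    by (rule delta2_on_All[OF assms(1,2)]) (simp add: env_upd)
  then show ?thesis by (simp add: env_upd pts)
qed

lemma delta2_on_sat:
  assumes "well_formed \<Gamma> \<phi>"
  shows "delta2_on (env_names \<Gamma> (free_vars \<phi>)) (\<lambda>P. sat \<Gamma> (env \<Gamma> P) \<phi>)"
  using assms
proof (induction \<phi>)
  case (Atom R xs)
  then show ?case using delta2_on_Atom by simp
next
  case (Neg \<phi>)
  then show ?case using delta2_on_compose[of _ _ Not] by simp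
next
  case (Conj \<phi> \<psi>)
  \<comment> \<open>Demanding names for more variables shrinks the set of families, so both
    conjuncts restrict to a common domain.\<close>
  then have "delta2_on (env_names \<Gamma> (free_vars \<phi> \<union> free_vars \<psi>)) (\<lambda>P. sat \<Gamma> (env \<Gamma> P) \<phi>)"
    "delta2_on (env_names \<Gamma> (free_vars \<phi> \<union> free_vars \<psi>)) (\<lambda>P. sat \<Gamma> (env \<Gamma> P) \<psi>)"
    by (auto simp: env_names_def elim!: delta2_on_subset)
  then show ?case using delta2_on_binop[of _ _ _ "(\<and>)"] by simp
next
  case (Disj \<phi> \<psi>)
  then have "delta2_on (env_names \<Gamma> (free_vars \<phi> \<union> free_vars \<psi>)) (\<lambda>P. sat \<Gamma> (env \<Gamma> P) \<phi>)"
    "delta2_on (env_names \<Gamma> (free_vars \<phi> \<union> free_vars \<psi>)) (\<lambda>P. sat \<Gamma> (env \<Gamma> P) \<psi>)"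
    by (auto simp: env_names_def elim!: delta2_on_subset)
  then show ?case using delta2_on_binop[of _ _ _ "(\<or>)"] by simp
next
  case (All x \<phi>)
  then show ?case using delta2_on_forall_point[of \<Gamma> x "free_vars \<phi>" "\<lambda>\<sigma>. sat \<Gamma> \<sigma> \<phi>"] by simp
next
  case (Ex x \<phi>)
  \<comment> \<open>The existential quantifier is treated as the negation of a universal
    one.\<close>
  then have "delta2_on (env_names \<Gamma> (free_vars \<phi>)) (\<lambda>P. \<not> sat \<Gamma> (env \<Gamma> P) \<phi>)"
    using delta2_on_compose[of _ _ Not] by simp
  then have "delta2_on (env_names \<Gamma> (free_vars \<phi> - {x}))
      (\<lambda>P. \<forall>a \<in> points (\<Gamma> x). \<not> sat \<Gamma> ((env \<Gamma> P)(x := a)) \<phi>)"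
    using delta2_on_forall_point[of \<Gamma> x "free_vars \<phi>" "\<lambda>\<sigma>. \<not> sat \<Gamma> \<sigma> \<phi>"] Ex.prems by simp
  from delta2_on_compose[OF this, of Not] show ?case by simp
qed

lemma sat_cong:
  "(\<And>v. v \<in> free_vars \<phi> \<Longrightarrow> \<sigma> v = \<tau> v) \<Longrightarrow> sat \<Gamma> \<sigma> \<phi> = sat \<Gamma> \<tau> \<phi>"
proof (induction \<phi> arbitrary: \<sigma> \<tau>)
  case (Atom R xs)
  then have "map \<sigma> xs = map \<tau> xs" by simp
  then show ?case by (simp only: sat.simps)
next
  case (Neg \<phi>)
  then show ?case by (metis free_vars.simps(2) sat.simps(2))
next
  case (Conj \<phi> \<psi>)
  then show ?case by (metis UnCI free_vars.simps(3) sat.simps(3))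
next
  case (Disj \<phi> \<psi>)
  then show ?case by (metis UnCI free_vars.simps(4) sat.simps(4))
next
  case (All x \<phi>)
  have "sat \<Gamma> (\<sigma>(x := a)) \<phi> = sat \<Gamma> (\<tau>(x := a)) \<phi>" for a
    by (rule All.IH) (use All.prems in auto)
  then show ?case by simp
next
  case (Ex x \<phi>)
  have "sat \<Gamma> (\<sigma>(x := a)) \<phi> = sat \<Gamma> (\<tau>(x := a)) \<phi>" for a
    by (rule Ex.IH) (use Ex.prems in auto)
  then show ?case by simp
qed

section \<open>From families of names to tuples\<close>

lemma in_listset_iff: "xs \<in> listset As \<longleftrightarrow> list_all2 (\<in>) xs As"
  by (induction As arbitrary: xs) (auto simp: set_Cons_def list_all2_Cons2)

theorem corollary54:
  fixes \<Gamma> :: "'v \<Rightarrow> 'a rspace" and \<phi> :: "('v, 'a) formula" and ys :: "'v list"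
  assumes "\<And>v. represented_space (\<Gamma> v)"
    and "well_formed \<Gamma> \<phi>"
    and "distinct ys"
    and "free_vars \<phi> \<subseteq> set ys"
  shows "Delta02 (prod_rspace (map \<Gamma> ys)) (defined_set \<Gamma> ys \<phi>)"
proof (rule Delta02_of_delta2_on)
  let ?m = "length ys" and ?X = "prod_rspace (map \<Gamma> ys)"
  show "defined_set \<Gamma> ys \<phi> \<subseteq> points ?X" unfolding defined_set_def by auto
  \<comment> \<open>Distinctness of \<open>ys\<close> makes \<open>ix\<close> inverse to indexing.
    Outside \<open>ys\<close> its value is arbitrary, but \<open>G p v\<close> is still a component
    of \<open>p\<close>, so \<open>G\<close> is continuous.\<close>
  define ix where "ix v = (SOME i. i < ?m \<and> ys ! i = v)" for v
  have ix: "ix v < ?m \<and> ys ! ix v = v" if "v \<in> set ys" for v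
    using that unfolding ix_def in_set_conv_nth by (rule someI_ex)
  define G where "G p v = component ?m (ix v) p" for p v
  have G_nth: "component ?m i p = G p (ys ! i)" if "i < ?m" for i p
  proof -
    have "ix (ys ! i) = i" using that ix[of "ys ! i"] assms(3) by (metis nth_eq_iff_index_eq nth_mem)
    then show ?thesis by (simp add: G_def)
  qed
  have cont: "continuous_on S G" for S
  proof (intro continuous_on_coordinatewise_then_product)
    fix v n
    show "continuous_on S (\<lambda>p. G p v n)"
      unfolding G_def component_def by (rule continuous_on_coordinate)
  qed
  have G: "G p \<in> env_names \<Gamma> (set ys)" if "p \<in> names ?X" for p
  proof -
    have "\<forall>i<?m. component ?m i p \<in> names (map \<Gamma> ys ! i)"
      using that by (simp add: prod_rspace_def Let_def dom_def split: if_splits)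
    then have "G p v \<in> names (\<Gamma> v)" if "v \<in> set ys" for v
      using ix[OF that] unfolding G_def by (metis nth_map)
    then show ?thesis unfolding env_names_def by blast
  qed
  have sub: "env_names \<Gamma> (set ys) \<subseteq> env_names \<Gamma> (free_vars \<phi>)"
    using assms(4) unfolding env_names_def by blast
  have "delta2_on (names ?X) (\<lambda>p. sat \<Gamma> (env \<Gamma> (G p)) \<phi>)"
    by (rule delta2_on_preimage[OF delta2_on_sat[OF assms(2)] cont])
      (use G sub in blast)
  then show "delta2_on (names ?X) (\<lambda>p. the (rep ?X p) \<in> defined_set \<Gamma> ys \<phi>)"
  proof (rule delta2_on_cong)
    fix p assume "p \<in> names ?X"
    note G = G[OF this]
    let ?as = "map (env \<Gamma> (G p)) ys"
    have rep: "rep ?X p = Some ?as" using rep_prod_rspace[OF G_nth G] by simp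
    have "env \<Gamma> (G p) v \<in> points (\<Gamma> v)" if "v \<in> set ys" for v
      unfolding points_eq_image_rep[OF assms(1)]
      by (rule image_eqI[of _ _ "G p v"]) (use G that in \<open>simp_all add: env_names_def env_def\<close>)
    then have "?as \<in> points ?X"
      by (simp add: prod_rspace_def Let_def in_listset_iff list_all2_map1 list_all2_map2 list_all2_same)
    \<comment> \<open>The two assignments are only known to agree on \<open>ys\<close>, which
      contains all free variables.\<close>
    moreover have "sat \<Gamma> (the \<circ> map_of (zip ys ?as)) \<phi> = sat \<Gamma> (env \<Gamma> (G p)) \<phi>"
      by (rule sat_cong) (use assms(4) in \<open>auto simp: map_of_zip_map\<close>)
    ultimately show "sat \<Gamma> (env \<Gamma> (G p)) \<phi> = (the (rep ?X p) \<in> defined_set \<Gamma> ys \<phi>)"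
      unfolding rep defined_set_def by simp
  qed
qed

end
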